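(* Let $\alpha>\beta$ and $\tau>0$ be constants, and let $G_n\sim \mathrm{SBM}(n,\mu_1,\mu_2,\tau^2)$ with $\mu_1=\alpha\sqrt{\frac{\log n}{n}}$, $\mu_2=\beta\sqrt{\frac{\log n}{n}}$ and planted labeling $\sigma^*\in\Theta_n$. Let $\mathrm{SNR}=\frac{(\alpha-\beta)^2}{8\tau^2}$. If $\mathrm{SNR}>1$, then the maximum likelihood estimator recovers $\sigma^*$: $$\mathbb{P}\left[M(\hat\sigma_{MLE},\sigma^* )=1\right]\to 1\quad\text{as } n\to\infty .$$
   Context: $n$ is even, $[n]=\{1,\dots,n\}$, and $\Theta_n=\{\sigma\in\{\pm1\}^n:\sum_i\sigma_i=0\}$. Gaussian weighted stochastic block model $\mathrm{SBM}(n,\mu_1,\mu_2,\tau^2)$: given a planted (unobserved) labeling $\sigma^*\in\Theta_n$, the observed symmetric weighted adjacency matrix $A=(A_{ij})_{i,j\in[n]}$ has $A_{ii}=0$, and, independently over unordered pairs $\{i,j\}$ with $i\ne j$, $A_{ij}=A_{ji}\sim N(\mu_1,\tau^2)$ if $\sigma^*_i=\sigma^*_j$ and $A_{ij}=A_{ji}\sim N(\mu_2,\tau^2)$ if $\sigma^*_i\neq\sigma^*_j$ ($N(\mu,\tau^2)$ is the normal law with mean $\mu$ and variance $\tau^2$). Agreement ratio: $M(\hat\sigma,\sigma)=\max\left(\frac1n\sum_{i=1}^n\mathbf 1_{\hat\sigma_i=\sigma_i},\ \frac1n\sum_{i=1}^n\mathbf 1_{-\hat\sigma_i=\sigma_i}\right)$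 for $\hat\sigma,\sigma\in\{\pm1\}^n$. The maximum likelihood estimator is $\hat\sigma_{MLE}\in\arg\max_{\sigma\in\Theta_n} f_A(\sigma)$ with $f_A(\sigma)=\sum_{i,j}A_{ij}\sigma_i\sigma_j$ (almost surely unique up to a global sign). *)

theory Defs
  imports "HOL-Probability.Probability"
begin

text \<open>Labelings of \<open>{1..n}\<close> are taken to be extensional, so that \<open>labelings n\<close> is a finite
  set of size \<open>2 ^ n\<close> and distinct elements differ at some vertex.\<close>

definition labelings :: "nat \<Rightarrow> (nat \<Rightarrow> real) set" where
  "labelings n = {1..n} \<rightarrow>\<^sub>E {1, -1}"

definition balanced_labelings :: "nat \<Rightarrow> (nat \<Rightarrow> real) set" where
  "balanced_labelings n = {s \<in> labelings n. (\<Sum>i=1..n. s i) = 0}"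

text \<open>The parameter \<open>v\<close> is the variance of the edge weights, whereas the second argument of
  \<^const>\<open>normal_density\<close> is a standard deviation. Independence is over unordered pairs, which are
  represented by the pairs \<open>(i, j)\<close> with \<open>i < j\<close>. The planted labeling is deterministic.\<close>

locale gaussian_sbm = prob_space M
  for M :: "'a measure"
    and n :: nat
    and \<mu>1 \<mu>2 v :: real
    and planted :: "nat \<Rightarrow> real"
    and A :: "nat \<Rightarrow> nat \<Rightarrow> 'a \<Rightarrow> real" +
  assumes even_n: "even n"
    and planted: "planted \<in> balanced_labelings n"
    and diag: "\<And>i \<omega>. i \<in> {1..n} \<Longrightarrow> \<omega> \<in> space M \<Longrightarrow> A i i \<omega> = 0"
    and sym: "\<And>i j \<omega>. i \<in> {1..n} \<Longrightarrow> j \<in> {1..n} \<Longrightarrow> \<omega> \<in> space M \<Longrightarrow> A i j \<omega> = A j i \<omega>"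
    and indep: "indep_vars (\<lambda>_. borel) (\<lambda>(i, j). A i j) {(i, j). 1 \<le> i \<and> i < j \<and> j \<le> n}"
    and same: "\<And>i j. 1 \<le> i \<Longrightarrow> i < j \<Longrightarrow> j \<le> n \<Longrightarrow> planted i = planted j \<Longrightarrow>
      distributed M lborel (A i j) (normal_density \<mu>1 (sqrt v))"
    and different: "\<And>i j. 1 \<le> i \<Longrightarrow> i < j \<Longrightarrow> j \<le> n \<Longrightarrow> planted i \<noteq> planted j \<Longrightarrow>
      distributed M lborel (A i j) (normal_density \<mu>2 (sqrt v))"

definition agreement :: "nat \<Rightarrow> (nat \<Rightarrow> real) \<Rightarrow> (nat \<Rightarrow> real) \<Rightarrow> real" where
  "agreement n s t = max (1 / real n * (\<Sum>i=1..n. of_bool (s i = t i)))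
                         (1 / real n * (\<Sum>i=1..n. of_bool (- s i = t i)))"

definition quad_form :: "nat \<Rightarrow> (nat \<Rightarrow> nat \<Rightarrow> real) \<Rightarrow> (nat \<Rightarrow> real) \<Rightarrow> real" where
  "quad_form n a s = (\<Sum>i=1..n. \<Sum>j=1..n. a i j * s i * s j)"

text \<open>The maximizer is never unique (both \<open>s\<close> and its negation maximize), so an MLE is any random
  labeling that always selects one. The selection has to be measurable: \<^const>\<open>measure\<close> is \<open>0\<close> on
  non-measurable sets.\<close>

definition is_mle ::
  "'a measure \<Rightarrow> nat \<Rightarrow> (nat \<Rightarrow> nat \<Rightarrow> 'a \<Rightarrow> real) \<Rightarrow> ('a \<Rightarrow> nat \<Rightarrow> real) \<Rightarrow> bool" where
  "is_mle M n A \<sigma>hat \<longleftrightarrow>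
     \<sigma>hat \<in> measurable M (count_space (balanced_labelings n)) \<and>
     (\<forall>\<omega>\<in>space M. is_arg_max (quad_form n (\<lambda>i j. A i j \<omega>))
        (\<lambda>s. s \<in> balanced_labelings n) (\<sigma>hat \<omega>))"

end

theory Submission
  imports Defs "HOL-Real_Asymp.Real_Asymp"
begin

text \<open>
  The proof is a union bound over the ways in which a balanced labeling can differ from the planted
  labeling \<open>p\<close>. Such a labeling arises by flipping the signs of \<open>p\<close> on a set \<open>D\<close> of vertices, and
  since \<open>p\<close> is balanced, the result is balanced exactly when \<open>p\<close> sums to zero on \<open>D\<close>. The likelihood and the agreement do
  not see a global sign, so \<open>D\<close> may be replaced by its complement and \<open>d = card D\<close> is at most \<open>n/2\<close>;
  failure of the estimator means that some nonempty \<open>D\<close> of this kind does not decrease the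
  likelihood.

  Flipping \<open>D\<close> only affects the edges that cross from \<open>D\<close> to its complement. The likelihood drops by
  four times the sum of \<open>A i j * p i * p j\<close> over these \<open>d * (n - d)\<close> edges
  (\<open>quad_form_flip\<close>). As \<open>p\<close> sums to zero on \<open>D\<close>, half of the crossing edges join equal labels and
  half join different labels. Hence this sum is Gaussian with mean
  \<open>d * (n - d) * (\<mu>1 - \<mu>2) / 2\<close> and variance \<open>d * (n - d) * v\<close> (\<open>cut_gain_distributed\<close>), and it is
  nonpositive with probability at most \<open>exp (- (d * (n - d) * (\<mu>1 - \<mu>2)\<^sup>2 / (8 * v)))\<close>. In the scaling
  of the theorem, with \<open>S\<close> the signal-to-noise ratio, this bound is the \<open>d\<close>-th power of
  \<open>n powr (- S * (1 - d / n))\<close>.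

  It remains to weigh it against the number \<open>n choose d\<close> of sets (\<open>binomial_mult_exp_le\<close>). If \<open>d\<close> is
  a small fraction of \<open>n\<close>, the exponent is close to \<open>- S\<close>, and \<open>S > 1\<close> beats the count
  \<open>n choose d \<le> n ^ d\<close>; this is where the threshold comes from. If \<open>d\<close> is of order \<open>n\<close>, the exponent is
  still at most \<open>- S / 2\<close>, and the count \<open>n choose d \<le> 2 ^ n\<close> is only the \<open>d\<close>-th power of a constant.
  In both cases the \<open>d\<close>-th term is at most \<open>q ^ d\<close> with a common ratio \<open>q\<close> that tends to zero, so that
  the geometric series bounds the probability of failure by \<open>q / (1 - q)\<close>.
\<close>

section \<open>The lower tail of a Gaussian variable\<close>

text \<open>For \<open>x \<le> 0 \<le> m\<close> the cross term of \<open>(x - m)\<^sup>2\<close> is nonnegative, so on the negative half-line the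
  density with mean \<open>m\<close> is at most \<open>exp (- (m\<^sup>2 / (2 * s\<^sup>2)))\<close> times the centred one, whose integral
  is 1.\<close>

lemma (in prob_space) normal_prob_nonpos_le:
  fixes X :: "'a \<Rightarrow> real"
  assumes X: "distributed M lborel X (normal_density m s)" and m: "m \<ge> 0" and s: "s > 0"
  shows "\<P>(\<omega> in M. X \<omega> \<le> 0) \<le> exp (- (m\<^sup>2 / (2 * s\<^sup>2)))"
proof -
  have "emeasure M (X -` {..0} \<inter> space M)
      = (\<integral>\<^sup>+x. ennreal (normal_density m s x) * indicator {..0} x \<partial>lborel)"
    by (rule distributed_emeasure[OF X]) simp
  also have "\<dots> \<le> (\<integral>\<^sup>+x. ennreal (exp (- (m\<^sup>2 / (2 * s\<^sup>2)))) * ennreal (normal_density 0 s x) \<partial>lborel)"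
  proof (rule nn_integral_mono)
    fix x :: real
    have "normal_density m s x \<le> exp (- (m\<^sup>2 / (2 * s\<^sup>2))) * normal_density 0 s x" if "x \<le> 0"
    proof -
      have "x\<^sup>2 + m\<^sup>2 \<le> (x - m)\<^sup>2"
        using mult_nonpos_nonneg[OF that m] by (simp add: power2_eq_square algebra_simps)
      then have "- (x - m)\<^sup>2 / (2 * s\<^sup>2) \<le> - (m\<^sup>2 / (2 * s\<^sup>2)) + - (x - 0)\<^sup>2 / (2 * s\<^sup>2)"
        using s by (simp add: field_simps)
      then have "exp (- (x - m)\<^sup>2 / (2 * s\<^sup>2))
          \<le> exp (- (m\<^sup>2 / (2 * s\<^sup>2))) * exp (- (x - 0)\<^sup>2 / (2 * s\<^sup>2))"
        by (simp only: exp_add[symmetric] exp_le_cancel_iff)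
      then have "1 / sqrt (2 * pi * s\<^sup>2) * exp (- (x - m)\<^sup>2 / (2 * s\<^sup>2))
          \<le> 1 / sqrt (2 * pi * s\<^sup>2) * (exp (- (m\<^sup>2 / (2 * s\<^sup>2))) * exp (- (x - 0)\<^sup>2 / (2 * s\<^sup>2)))"
        by (rule mult_left_mono) simp
      then show ?thesis
        unfolding normal_density_def by (simp only: mult_ac)
    qed
    then show "ennreal (normal_density m s x) * indicator {..0} x
        \<le> ennreal (exp (- (m\<^sup>2 / (2 * s\<^sup>2)))) * ennreal (normal_density 0 s x)"
      by (auto simp: indicator_def ennreal_mult[symmetric] intro!: ennreal_leI)
  qed
  also have "\<dots> = ennreal (exp (- (m\<^sup>2 / (2 * s\<^sup>2)))) * (\<integral>\<^sup>+x. ennreal (normal_density 0 s x) \<partial>lborel)"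
    by (rule nn_integral_cmult) simp
  also have "(\<integral>\<^sup>+x. ennreal (normal_density 0 s x) \<partial>lborel) = ennreal (\<integral>x. normal_density 0 s x \<partial>lborel)"
    using s by (intro nn_integral_eq_integral) auto
  also have "\<dots> = 1"
    using s by simp
  finally have "emeasure M (X -` {..0} \<inter> space M) \<le> ennreal (exp (- (m\<^sup>2 / (2 * s\<^sup>2))))"
    by simp
  moreover have "X -` {..0} \<inter> space M = {\<omega> \<in> space M. X \<omega> \<le> 0}"
    by auto
  ultimately show ?thesis
    by (simp add: emeasure_eq_measure)
qed

section \<open>Flipping a set of labels\<close>

definition cut_gain :: "nat \<Rightarrow> (nat \<Rightarrow> real) \<Rightarrow> (nat \<Rightarrow> nat \<Rightarrow> real) \<Rightarrow> nat set \<Rightarrow> real" where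
  "cut_gain n p a D = (\<Sum>i\<in>D. \<Sum>j\<in>{1..n} - D. a i j * p i * p j)"

text \<open>Independence of the edge weights concerns the pairs with \<open>i < j\<close>, whereas the sums over
  \<open>D \<times> ({1..n} - D)\<close> factor and are easy to count. The lemma \<open>sum_cut_pairs\<close> passes between the two
  indexings of the edges that leave \<open>D\<close>.\<close>

definition cut_pairs :: "nat \<Rightarrow> nat set \<Rightarrow> (nat \<times> nat) set" where
  "cut_pairs n D = {(i, j). 1 \<le> i \<and> i < j \<and> j \<le> n \<and> (i \<in> D) \<noteq> (j \<in> D)}"

lemma finite_cut_pairs: "finite (cut_pairs n D)"
  by (rule finite_subset[of _ "{1..n} \<times> {1..n}"]) (auto simp: cut_pairs_def)

lemma sum_cut_pairs:
  fixes g :: "nat \<Rightarrow> nat \<Rightarrow> 'b::comm_monoid_add"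
  assumes D: "D \<subseteq> {1..n}"
    and g: "\<And>i j. i \<in> {1..n} \<Longrightarrow> j \<in> {1..n} \<Longrightarrow> g i j = g j i"
  shows "(\<Sum>(i, j)\<in>cut_pairs n D. g i j) = (\<Sum>i\<in>D. \<Sum>j\<in>{1..n} - D. g i j)"
proof -
  have "finite D"
    using D finite_subset by blast
  then have "(\<Sum>i\<in>D. \<Sum>j\<in>{1..n} - D. g i j) = (\<Sum>(i, j)\<in>D \<times> ({1..n} - D). g i j)"
    by (simp add: sum.cartesian_product)
  also have "\<dots> = (\<Sum>(i, j)\<in>cut_pairs n D. g i j)"
  proof (rule sum.reindex_bij_witness[where
        i = "\<lambda>(i, j). if i \<in> D then (i, j) else (j, i)" and j = "\<lambda>(i, j). (min i j, max i j)"],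
      goal_cases)
    case (1 a) then show ?case by (cases a) (auto simp: min_def max_def)
  next
    case (2 a)
    then obtain i j where "a = (i, j)" "i \<in> D" "j \<in> {1..n}" "j \<notin> D"
      by auto
    moreover from this have "i \<in> {1..n}" "i \<noteq> j"
      using D by auto
    ultimately show ?case
      by (auto simp: cut_pairs_def min_def max_def)
  next
    case (3 b) then show ?case by (cases b) (auto simp: cut_pairs_def)
  next
    case (4 b)
    then show ?case
      using D by (cases b) (auto simp: cut_pairs_def)
  next
    case (5 a)
    then show ?case
      using D g by (cases a) (auto simp: min_def max_def)
  qed
  finally show ?thesis ..
qed

lemma cut_gain_Diff:
  assumes "D \<subseteq> {1..n}" and "\<And>i j. i \<in> {1..n} \<Longrightarrow> j \<in> {1..n} \<Longrightarrow> a i j = a j i"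
  shows "cut_gain n p a ({1..n} - D) = cut_gain n p a D"
proof -
  have "{1..n} - ({1..n} - D) = D"
    using assms(1) by blast
  then have "cut_gain n p a ({1..n} - D) = (\<Sum>i\<in>{1..n} - D. \<Sum>j\<in>D. a i j * p i * p j)"
    by (simp only: cut_gain_def)
  also have "\<dots> = (\<Sum>j\<in>D. \<Sum>i\<in>{1..n} - D. a i j * p i * p j)"
    by (rule sum.swap)
  also have "\<dots> = cut_gain n p a D"
    unfolding cut_gain_def
  proof (intro sum.cong refl)
    fix j i assume "j \<in> D" "i \<in> {1..n} - D"
    then have "a i j = a j i"
      using assms(1) by (intro assms(2)) auto
    then show "a i j * p i * p j = a j i * p j * p i"
      by simp
  qed
  finally show ?thesis .
qed

text \<open>A summand of the quadratic form changes, by a sign, exactly when one of its two indices lies in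
  \<open>D\<close>. The factor 4 is a factor 2 for the sign change times 2 for the two orders of the indices.\<close>

lemma quad_form_flip:
  assumes D: "D \<subseteq> {1..n}"
    and a: "\<And>i j. i \<in> {1..n} \<Longrightarrow> j \<in> {1..n} \<Longrightarrow> a i j = a j i"
    and s: "\<And>i. i \<in> {1..n} \<Longrightarrow> s i = (if i \<in> D then - p i else p i)"
  shows "quad_form n a p - quad_form n a s = 4 * cut_gain n p a D"
proof -
  define V where "V = {1..n}"
  have DV: "D \<subseteq> V"
    using D by (simp add: V_def)
  have DD: "V - (V - D) = D" "(V - D) \<inter> D = {}"
    using DV by auto
  have fin: "finite V"
    by (simp add: V_def)
  have split: "(\<Sum>i\<in>V. h i) = (\<Sum>i\<in>D. h i) + (\<Sum>i\<in>V - D. h i)" for h :: "nat \<Rightarrow> real"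
    using sum.subset_diff[OF DV fin, of h] by simp
  define e where "e i j = a i j * p i * p j - a i j * s i * s j" for i j
  have e1: "e i j = 0" if "i \<in> V" "j \<in> V" "i \<in> D \<longleftrightarrow> j \<in> D" for i j
    using that s[of i] s[of j] unfolding e_def V_def by auto
  have e2: "e i j = 2 * (a i j * p i * p j)" if "i \<in> V" "j \<in> V" "(i \<in> D) \<noteq> (j \<in> D)" for i j
    using that s[of i] s[of j] unfolding e_def V_def by auto
  have "quad_form n a p - quad_form n a s = (\<Sum>i\<in>V. \<Sum>j\<in>V. e i j)"
    by (simp add: quad_form_def sum_subtractf e_def V_def)
  also have "\<dots> = (\<Sum>i\<in>D. (\<Sum>j\<in>D. e i j) + (\<Sum>j\<in>V - D. e i j))
      + (\<Sum>i\<in>V - D. (\<Sum>j\<in>D. e i j) + (\<Sum>j\<in>V - D. e i j))"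
    by (simp only: split)
  also have "\<dots> = (\<Sum>i\<in>D. \<Sum>j\<in>V - D. e i j) + (\<Sum>i\<in>V - D. \<Sum>j\<in>D. e i j)"
  proof -
    have "(\<Sum>j\<in>D. e i j) = 0" if "i \<in> D" for i
      using that DV by (intro sum.neutral) (auto intro!: e1)
    moreover have "(\<Sum>j\<in>V - D. e i j) = 0" if "i \<in> V - D" for i
      using that DV by (intro sum.neutral) (auto intro!: e1)
    ultimately show ?thesis
      by simp
  qed
  also have "(\<Sum>i\<in>D. \<Sum>j\<in>V - D. e i j) = 2 * cut_gain n p a D"
    unfolding cut_gain_def V_def[symmetric] sum_distrib_left
    using DV by (intro sum.cong refl e2) auto
  also have "(\<Sum>i\<in>V - D. \<Sum>j\<in>D. e i j) = 2 * cut_gain n p a (V - D)"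
    unfolding cut_gain_def V_def[symmetric] sum_distrib_left DD
    using DV by (intro sum.cong refl e2) auto
  also have "cut_gain n p a (V - D) = cut_gain n p a D"
    unfolding V_def by (rule cut_gain_Diff[OF D a])
  finally show ?thesis
    by simp
qed

definition flip_sets :: "nat \<Rightarrow> (nat \<Rightarrow> real) \<Rightarrow> nat set set" where
  "flip_sets n p = {D. D \<subseteq> {1..n} \<and> D \<noteq> {} \<and> 2 * card D \<le> n \<and> (\<Sum>i\<in>D. p i) = 0}"

lemma finite_flip_sets: "finite (flip_sets n p)"
  by (rule finite_subset[of _ "Pow {1..n}"]) (auto simp: flip_sets_def)

text \<open>The set on which a maximizer disagrees with the planted labeling, or its complement, is small
  enough to be a flip set; the two have the same gain. Both are nonempty because otherwise the
  agreement would be 1.\<close>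

lemma arg_max_imp_cut_gain_nonpos:
  assumes n: "n > 0" and p: "p \<in> balanced_labelings n"
    and a: "\<And>i j. i \<in> {1..n} \<Longrightarrow> j \<in> {1..n} \<Longrightarrow> a i j = a j i"
    and s: "is_arg_max (quad_form n a) (\<lambda>s. s \<in> balanced_labelings n) s"
    and neq: "agreement n s p \<noteq> 1"
  shows "\<exists>D\<in>flip_sets n p. cut_gain n p a D \<le> 0"
proof -
  define D where "D = {i \<in> {1..n}. s i \<noteq> p i}"
  have sb: "s \<in> balanced_labelings n"
    using s by (simp add: is_arg_max_def)
  have D: "D \<subseteq> {1..n}"
    by (auto simp: D_def)
  then have finD: "finite D"
    using finite_subset by blast
  have vals: "s i \<in> {1, -1}" "p i \<in> {1, -1}" if "i \<in> {1..n}" for i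
    using that sb p unfolding balanced_labelings_def labelings_def by (auto dest: PiE_mem)
  have flip: "s i = (if i \<in> D then - p i else p i)" if "i \<in> {1..n}" for i
    using vals[OF that] that by (auto simp: D_def)
  have split: "(\<Sum>i\<in>{1..n}. h i) = (\<Sum>i\<in>D. h i) + (\<Sum>i\<in>{1..n} - D. h i)" for h :: "nat \<Rightarrow> real"
    using sum.subset_diff[OF D, of h] by simp
  have "(\<Sum>i=1..n. s i) = - (\<Sum>i\<in>D. p i) + (\<Sum>i\<in>{1..n} - D. p i)"
    unfolding split sum_negf[symmetric]
    using D by (intro arg_cong2[where f = "(+)"] sum.cong refl) (auto simp: flip subsetD)
  moreover have "(\<Sum>i=1..n. s i) = 0" "(\<Sum>i=1..n. p i) = 0"
    using sb p by (auto simp: balanced_labelings_def)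
  ultimately have sums: "(\<Sum>i\<in>D. p i) = 0" "(\<Sum>i\<in>{1..n} - D. p i) = 0"
    using split[of p] by auto
  have one: "1 / real n * x = 1" if "x = (\<Sum>i=1..n. 1)" for x :: real
    using n that by simp
  have le1: "1 / real n * (\<Sum>i=1..n. of_bool (P i)) \<le> 1" for P
  proof -
    have "(\<Sum>i=1..n. of_bool (P i)) \<le> (\<Sum>i=1..n. 1 :: real)"
      by (intro sum_mono) auto
    then show ?thesis
      using n by (simp add: field_simps)
  qed
  have "D \<noteq> {}"
  proof
    assume "D = {}"
    then have "(\<Sum>i=1..n. of_bool (s i = p i)) = (\<Sum>i=1..n. 1 :: real)"
      by (intro sum.cong) (auto simp: D_def)
    then have "1 / real n * (\<Sum>i=1..n. of_bool (s i = p i)) = 1"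
      by (rule one)
    then have "agreement n s p = 1"
      unfolding agreement_def using le1[of "\<lambda>i. - s i = p i"] by linarith
    then show False
      using neq by contradiction
  qed
  have "{1..n} - D \<noteq> {}"
  proof
    assume "{1..n} - D = {}"
    then have "(\<Sum>i=1..n. of_bool (- s i = p i)) = (\<Sum>i=1..n. 1 :: real)"
      using flip by (intro sum.cong) auto
    then have "1 / real n * (\<Sum>i=1..n. of_bool (- s i = p i)) = 1"
      by (rule one)
    then have "agreement n s p = 1"
      unfolding agreement_def using le1[of "\<lambda>i. s i = p i"] by linarith
    then show False
      using neq by contradiction
  qed
  have "quad_form n a p \<le> quad_form n a s"
    using s p by (auto simp: is_arg_max_def not_less)
  moreover have "quad_form n a p - quad_form n a s = 4 * cut_gain n p a D"
    by (rule quad_form_flip[OF D a flip])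
  ultimately have gain: "cut_gain n p a D \<le> 0"
    by linarith
  show ?thesis
  proof (cases "2 * card D \<le> n")
    case True
    then show ?thesis
      using D \<open>D \<noteq> {}\<close> sums gain by (auto simp: flip_sets_def)
  next
    case False
    have "card ({1..n} - D) = n - card D"
      using D finD by (simp add: card_Diff_subset)
    then have "{1..n} - D \<in> flip_sets n p"
      using False \<open>{1..n} - D \<noteq> {}\<close> sums by (auto simp: flip_sets_def)
    moreover have "cut_gain n p a ({1..n} - D) = cut_gain n p a D"
      by (rule cut_gain_Diff[OF D a])
    ultimately show ?thesis
      using gain by (intro bexI[of _ "{1..n} - D"]) simp_all
  qed
qed

section \<open>Probability that one flip does not decrease the likelihood\<close>

context gaussian_sbm
begin

lemma planted_values: "i \<in> {1..n} \<Longrightarrow> planted i = 1 \<or> planted i = -1"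
  using planted unfolding balanced_labelings_def labelings_def by (auto dest: PiE_mem)

text \<open>With \<open>w = planted i * planted j\<close>, the edge weight has mean \<open>(\<mu>1 + \<mu>2) / 2 + w * (\<mu>1 - \<mu>2) / 2\<close>, so
  its product with \<open>w\<close> has mean \<open>w * (\<mu>1 + \<mu>2) / 2 + (\<mu>1 - \<mu>2) / 2\<close>. Summed over the crossing edges,
  the first part is a multiple of the product of the label sums over \<open>D\<close> and over its complement, hence
  zero.\<close>

lemma cut_gain_distributed:
  assumes v: "v > 0" and D: "D \<in> flip_sets n planted"
  defines "N \<equiv> real (card D) * real (n - card D)"
  shows "distributed M lborel (\<lambda>\<omega>. cut_gain n planted (\<lambda>i j. A i j \<omega>) D)
           (normal_density (N * (\<mu>1 - \<mu>2) / 2) (sqrt (N * v)))"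
    and "N > 0"
proof -
  have DV: "D \<subseteq> {1..n}" and D0: "D \<noteq> {}" "2 * card D \<le> n" "(\<Sum>i\<in>D. planted i) = 0"
    using D by (auto simp: flip_sets_def)
  have finD: "finite D"
    using DV finite_subset by blast
  then have "card D > 0"
    using D0 by auto
  then show Npos: "N > 0"
    using D0 by (simp add: N_def)
  let ?C = "cut_pairs n D"
  define X where "X = (\<lambda>(i, j) \<omega>. planted i * planted j * A i j \<omega>)"
  define m where "m = (\<lambda>(i, j). planted i * planted j * ((\<mu>1 + \<mu>2) / 2) + (\<mu>1 - \<mu>2) / 2)"
  have "real (card ?C) = (\<Sum>(i, j)\<in>?C. 1)"
    by (simp add: case_prod_beta)
  also have "\<dots> = (\<Sum>i\<in>D. \<Sum>j\<in>{1..n} - D. 1 :: real)"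
    by (rule sum_cut_pairs[OF DV]) simp
  also have "\<dots> = N"
    using DV finD by (simp add: N_def card_Diff_subset)
  finally have card: "real (card ?C) = N" .
  then have "?C \<noteq> {}"
    using Npos by auto
  have "(\<Sum>(i, j)\<in>?C. planted i * planted j) = (\<Sum>i\<in>D. \<Sum>j\<in>{1..n} - D. planted i * planted j)"
    by (rule sum_cut_pairs[OF DV]) (simp add: mult.commute)
  also have "\<dots> = (\<Sum>i\<in>D. planted i) * (\<Sum>j\<in>{1..n} - D. planted j)"
    by (simp add: sum_product)
  finally have cross: "(\<Sum>(i, j)\<in>?C. planted i * planted j) = 0"
    using D0 by simp
  have "(\<Sum>c\<in>?C. m c) = (\<Sum>(i, j)\<in>?C. planted i * planted j) * ((\<mu>1 + \<mu>2) / 2)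
      + real (card ?C) * ((\<mu>1 - \<mu>2) / 2)"
    by (simp add: m_def case_prod_beta sum.distrib sum_distrib_right del: add_divide_distrib)
  then have mean: "(\<Sum>c\<in>?C. m c) = N * (\<mu>1 - \<mu>2) / 2"
    by (simp add: cross card)
  have var: "(\<Sum>c\<in>?C. (sqrt v)\<^sup>2) = N * v"
    using v by (simp add: card)
  have "indep_vars (\<lambda>_. borel) (\<lambda>(i, j). A i j) ?C"
    by (rule indep_vars_subset[OF indep]) (auto simp: cut_pairs_def)
  then have "indep_vars (\<lambda>_. borel)
      (\<lambda>c \<omega>. (planted (fst c) * planted (snd c)) * (case c of (i, j) \<Rightarrow> A i j) \<omega>) ?C"
    by (rule indep_vars_compose2) simp
  then have ind: "indep_vars (\<lambda>_. borel) X ?C"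
    by (simp add: X_def case_prod_beta')
  have normal: "distributed M lborel (X c) (normal_density (m c) (sqrt v))" if c: "c \<in> ?C" for c
  proof -
    obtain i j where ij: "c = (i, j)" "1 \<le> i" "i < j" "j \<le> n"
      using c by (cases c) (auto simp: cut_pairs_def)
    define w where "w = planted i * planted j"
    have w: "w = 1 \<and> planted i = planted j \<or> w = -1 \<and> planted i \<noteq> planted j"
      using planted_values[of i] planted_values[of j] ij by (auto simp: w_def)
    have "distributed M lborel (A i j) (normal_density (if w = 1 then \<mu>1 else \<mu>2) (sqrt v))"
      using same[of i j] different[of i j] ij w by auto
    then have "distributed M lborel (\<lambda>\<omega>. 0 + w * A i j \<omega>)
        (normal_density (0 + w * (if w = 1 then \<mu>1 else \<mu>2)) (\<bar>w\<bar> * sqrt v))"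
      using w v by (intro normal_density_affine) auto
    moreover have "0 + w * (if w = 1 then \<mu>1 else \<mu>2) = m c"
      unfolding m_def ij prod.case w_def[symmetric] using w by (auto simp: field_simps)
    moreover have "\<bar>w\<bar> = 1"
      using w by auto
    moreover have "X c = (\<lambda>\<omega>. 0 + w * A i j \<omega>)"
      by (simp add: X_def ij w_def)
    ultimately show ?thesis
      by simp
  qed
  have "distributed M lborel (\<lambda>\<omega>. \<Sum>c\<in>?C. X c \<omega>)
      (normal_density (\<Sum>c\<in>?C. m c) (sqrt (\<Sum>c\<in>?C. (sqrt v)\<^sup>2)))"
    using v by (intro sum_indep_normal finite_cut_pairs ind normal \<open>?C \<noteq> {}\<close>) auto
  then have dist: "distributed M lborel (\<lambda>\<omega>. \<Sum>c\<in>?C. X c \<omega>)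
      (normal_density (N * (\<mu>1 - \<mu>2) / 2) (sqrt (N * v)))"
    by (simp only: mean var)
  have "(\<Sum>c\<in>?C. X c \<omega>) = cut_gain n planted (\<lambda>i j. A i j \<omega>) D" if "\<omega> \<in> space M" for \<omega>
  proof -
    have "(\<Sum>c\<in>?C. X c \<omega>) = (\<Sum>(i, j)\<in>?C. A i j \<omega> * planted i * planted j)"
      by (simp add: X_def case_prod_beta' mult_ac)
    also have "\<dots> = cut_gain n planted (\<lambda>i j. A i j \<omega>) D"
      unfolding cut_gain_def by (rule sum_cut_pairs[OF DV]) (simp add: sym[OF _ _ that] mult_ac)
    finally show ?thesis .
  qed
  \<comment> \<open>the weights are symmetric only on the space of \<open>M\<close>, so the two functions may differ outside it\<close>
  then have "distr M lborel (\<lambda>\<omega>. cut_gain n planted (\<lambda>i j. A i j \<omega>) D)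
      = distr M lborel (\<lambda>\<omega>. \<Sum>c\<in>?C. X c \<omega>)"
    and "(\<lambda>\<omega>. cut_gain n planted (\<lambda>i j. A i j \<omega>) D) \<in> measurable M lborel
      \<longleftrightarrow> (\<lambda>\<omega>. \<Sum>c\<in>?C. X c \<omega>) \<in> measurable M lborel"
    by (auto intro!: distr_cong cong: measurable_cong)
  then show "distributed M lborel (\<lambda>\<omega>. cut_gain n planted (\<lambda>i j. A i j \<omega>) D)
      (normal_density (N * (\<mu>1 - \<mu>2) / 2) (sqrt (N * v)))"
    using dist unfolding distributed_def by simp
qed

lemma prob_cut_gain_nonpos_le:
  assumes v: "v > 0" and mu: "\<mu>2 \<le> \<mu>1" and D: "D \<in> flip_sets n planted"
  shows "\<P>(\<omega> in M. cut_gain n planted (\<lambda>i j. A i j \<omega>) D \<le> 0)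
    \<le> exp (- (real (card D) * real (n - card D) * (\<mu>1 - \<mu>2)\<^sup>2 / (8 * v)))"
proof -
  define N where "N = real (card D) * real (n - card D)"
  have N: "N > 0"
    unfolding N_def by (rule cut_gain_distributed(2)[OF v D])
  have "\<P>(\<omega> in M. cut_gain n planted (\<lambda>i j. A i j \<omega>) D \<le> 0)
      \<le> exp (- ((N * (\<mu>1 - \<mu>2) / 2)\<^sup>2 / (2 * (sqrt (N * v))\<^sup>2)))"
  proof (rule normal_prob_nonpos_le)
    show "distributed M lborel (\<lambda>\<omega>. cut_gain n planted (\<lambda>i j. A i j \<omega>) D)
        (normal_density (N * (\<mu>1 - \<mu>2) / 2) (sqrt (N * v)))"
      unfolding N_def by (rule cut_gain_distributed(1)[OF v D])
  qed (use N v mu in simp_all)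
  also have "(N * (\<mu>1 - \<mu>2) / 2)\<^sup>2 / (2 * (sqrt (N * v))\<^sup>2) = N * (\<mu>1 - \<mu>2)\<^sup>2 / (8 * v)"
    using N v by (simp add: power2_eq_square field_simps)
  finally show ?thesis
    by (simp add: N_def)
qed

section \<open>The union bound\<close>

text \<open>Failure of the estimator is covered by the events that a flip set has nonpositive gain. The
  bound for one of them depends on its size \<open>d\<close> only, and at most \<open>n choose d\<close> flip sets have this size.\<close>

lemma prob_mle_fails_le:
  assumes n: "n > 0" and v: "v > 0" and mu: "\<mu>2 \<le> \<mu>1" and mle: "is_mle M n A \<sigma>hat"
  shows "1 - \<P>(\<omega> in M. agreement n (\<sigma>hat \<omega>) planted = 1)
    \<le> (\<Sum>d=1..n div 2. real (n choose d) * exp (- (real d * real (n - d) * (\<mu>1 - \<mu>2)\<^sup>2 / (8 * v))))"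
proof -
  define h where "h d = exp (- (real d * real (n - d) * (\<mu>1 - \<mu>2)\<^sup>2 / (8 * v)))" for d
  define E where "E D = {\<omega> \<in> space M. cut_gain n planted (\<lambda>i j. A i j \<omega>) D \<le> 0}" for D
  let ?F = "flip_sets n planted"
  have meas: "\<sigma>hat \<in> measurable M (count_space (balanced_labelings n))"
    using mle by (simp add: is_mle_def)
  have "\<sigma>hat -` {s \<in> balanced_labelings n. agreement n s planted = 1} \<inter> space M \<in> events"
    by (rule measurable_sets[OF meas]) auto
  also have "\<sigma>hat -` {s \<in> balanced_labelings n. agreement n s planted = 1} \<inter> space M
      = {\<omega> \<in> space M. agreement n (\<sigma>hat \<omega>) planted = 1}"
    using measurable_space[OF meas] by auto
  finally have good: "{\<omega> \<in> space M. agreement n (\<sigma>hat \<omega>) planted = 1} \<in> events" .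
  have E: "E D \<in> events" if "D \<in> ?F" for D
  proof -
    have "(\<lambda>\<omega>. cut_gain n planted (\<lambda>i j. A i j \<omega>) D) \<in> borel_measurable M"
      using distributed_measurable[OF cut_gain_distributed(1)[OF v that]] by simp
    then show ?thesis
      unfolding E_def by measurable
  qed
  have "space M - {\<omega> \<in> space M. agreement n (\<sigma>hat \<omega>) planted = 1} \<subseteq> (\<Union>D\<in>?F. E D)"
  proof
    fix \<omega> assume "\<omega> \<in> space M - {\<omega> \<in> space M. agreement n (\<sigma>hat \<omega>) planted = 1}"
    then have \<omega>: "\<omega> \<in> space M" "agreement n (\<sigma>hat \<omega>) planted \<noteq> 1"
      by auto
    have "is_arg_max (quad_form n (\<lambda>i j. A i j \<omega>)) (\<lambda>s. s \<in> balanced_labelings n) (\<sigma>hat \<omega>)"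
      using mle \<omega> by (simp add: is_mle_def)
    then have "\<exists>D\<in>?F. cut_gain n planted (\<lambda>i j. A i j \<omega>) D \<le> 0"
      using sym[OF _ _ \<omega>(1)] \<omega>(2) by (intro arg_max_imp_cut_gain_nonpos[OF n planted]) auto
    then show "\<omega> \<in> (\<Union>D\<in>?F. E D)"
      using \<omega> by (auto simp: E_def)
  qed
  then have "prob (space M - {\<omega> \<in> space M. agreement n (\<sigma>hat \<omega>) planted = 1}) \<le> prob (\<Union>D\<in>?F. E D)"
    using E finite_flip_sets by (intro finite_measure_mono sets.finite_UN) auto
  also have "\<dots> \<le> (\<Sum>D\<in>?F. prob (E D))"
    using E finite_flip_sets by (intro finite_measure_subadditive_finite) auto
  also have "\<dots> \<le> (\<Sum>D\<in>?F. h (card D))"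
    unfolding E_def h_def by (intro sum_mono prob_cut_gain_nonpos_le[OF v mu])
  also have "\<dots> \<le> (\<Sum>D | D \<subseteq> {1..n} \<and> card D \<in> {1..n div 2}. h (card D))"
  proof (rule sum_mono2)
    show "?F \<subseteq> {D. D \<subseteq> {1..n} \<and> card D \<in> {1..n div 2}}"
    proof
      fix D assume D: "D \<in> ?F"
      then have "finite D"
        using finite_subset[of D "{1..n}"] by (simp add: flip_sets_def)
      with D have "card D > 0"
        by (auto simp: flip_sets_def card_gt_0_iff)
      with D show "D \<in> {D. D \<subseteq> {1..n} \<and> card D \<in> {1..n div 2}}"
        by (auto simp: flip_sets_def)
    qed
  qed (auto simp: h_def)
  also have "\<dots> = (\<Sum>d=1..n div 2. \<Sum>D | D \<in> {D. D \<subseteq> {1..n} \<and> card D \<in> {1..n div 2}} \<and> card D = d. h (card D))"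
    by (rule sum.group[symmetric]) auto
  also have "\<dots> = (\<Sum>d=1..n div 2. real (n choose d) * h d)"
  proof (rule sum.cong[OF refl])
    fix d assume "d \<in> {1..n div 2}"
    then have "{D. D \<in> {D. D \<subseteq> {1..n} \<and> card D \<in> {1..n div 2}} \<and> card D = d} = {D. D \<subseteq> {1..n} \<and> card D = d}"
      by auto
    then show "(\<Sum>D | D \<in> {D. D \<subseteq> {1..n} \<and> card D \<in> {1..n div 2}} \<and> card D = d. h (card D))
        = real (n choose d) * h d"
      by (simp add: n_subsets)
  qed
  finally show ?thesis
    using prob_compl[OF good] by (simp add: h_def)
qed

end

section \<open>Counting flip sets against the Gaussian tail\<close>

text \<open>The common ratio of the geometric series that dominates the union bound. The two summands control
  the flip sets that are small and those that are large in comparison with \<open>n\<close>; the second one carries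
  the constant \<open>2 powr (1 / \<epsilon>)\<close>, where \<open>\<epsilon> = (S - 1) / (2 * S)\<close> is the fraction \<open>d / n\<close> that separates
  them.\<close>

definition flip_ratio :: "real \<Rightarrow> nat \<Rightarrow> real" where
  "flip_ratio S n = real n powr ((1 - S) / 2) + 2 powr (2 * S / (S - 1)) * real n powr (- S / 2)"

lemma flip_ratio_tendsto_0:
  assumes "S > 1"
  shows "flip_ratio S \<longlonglongrightarrow> 0"
  unfolding flip_ratio_def using assms by real_asymp

lemma binomial_mult_exp_le:
  assumes S: "S > 1" and d: "1 \<le> d" "2 * d \<le> n"
  shows "real (n choose d) * exp (- (S * ln (real n) * (real d * real (n - d) / real n)))
    \<le> flip_ratio S n ^ d"
proof -
  define x where "x = real d / real n"
  define r where "r = real n powr (- S * (1 - x))"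
  \<comment> \<open>chosen so that \<open>S * (1 - \<epsilon>)\<close> is the midpoint of 1 and \<open>S\<close>, which still exceeds 1\<close>
  define \<epsilon> where "\<epsilon> = (S - 1) / (2 * S)"
  have n: "real n > 0" "real n \<ge> 1"
    using d by auto
  have x: "0 < x" "x \<le> 1 / 2" "real d = x * real n"
    using d n by (auto simp: x_def field_simps)
  have \<epsilon>: "\<epsilon> > 0" "S * (1 - \<epsilon>) = (S + 1) / 2" "1 / \<epsilon> = 2 * S / (S - 1)"
    using S by (auto simp: \<epsilon>_def field_simps)
  have size: "real d * real (n - d) / real n = real d * (1 - x)"
    using d n by (simp add: x_def of_nat_diff field_simps)
  have "exp (- (S * ln (real n) * (real d * real (n - d) / real n)))
      = exp (real d * (- S * (1 - x) * ln (real n)))"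
    unfolding size by (simp add: mult_ac)
  also have "\<dots> = exp (- S * (1 - x) * ln (real n)) ^ d"
    by (rule exp_of_nat_mult)
  also have "exp (- S * (1 - x) * ln (real n)) = r"
    using n by (simp add: r_def powr_def)
  finally have exp: "exp (- (S * ln (real n) * (real d * real (n - d) / real n))) = r ^ d" .
  have r: "r \<ge> 0"
    by (simp add: r_def)
  have "real (n choose d) * r ^ d \<le> flip_ratio S n ^ d"
  proof (cases "x \<le> \<epsilon>")
    case True
    have "n choose d \<le> n ^ d"
      using d by (intro binomial_le_pow) simp
    then have "real (n choose d) \<le> real n ^ d"
      by (metis of_nat_le_iff of_nat_power)
    then have "real (n choose d) * r ^ d \<le> (real n * r) ^ d"
      using r by (simp add: power_mult_distrib mult_right_mono)
    also have "real n * r = real n powr (1 - S * (1 - x))"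
      using n by (simp add: r_def powr_diff powr_minus_divide)
    also have "(real n powr (1 - S * (1 - x))) ^ d \<le> flip_ratio S n ^ d"
    proof (rule power_mono)
      have "S * (1 - \<epsilon>) \<le> S * (1 - x)"
        using True S by (intro mult_left_mono) auto
      then have "real n powr (1 - S * (1 - x)) \<le> real n powr ((1 - S) / 2)"
        using n \<epsilon> by (intro powr_mono) (auto simp: field_simps)
      then show "real n powr (1 - S * (1 - x)) \<le> flip_ratio S n"
        by (simp add: flip_ratio_def add_increasing2)
    qed simp
    finally show ?thesis .
  next
    case False
    have "real (n choose d) \<le> 2 ^ n"
      using binomial_le_pow2[of n d] by (metis of_nat_le_iff of_nat_numeral of_nat_power)
    also have "\<dots> = 2 powr real n"
      by (simp add: powr_realpow)
    also have "\<dots> \<le> 2 powr (1 / \<epsilon> * real d)"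
    proof (rule powr_mono)
      have "\<epsilon> * real n \<le> x * real n"
        using False n by (intro mult_right_mono) auto
      then show "real n \<le> 1 / \<epsilon> * real d"
        using \<epsilon>(1) x by (simp add: field_simps)
    qed simp
    also have "\<dots> = (2 powr (1 / \<epsilon>)) ^ d"
      by (simp add: powr_realpow[symmetric] powr_powr)
    finally have "real (n choose d) * r ^ d \<le> (2 powr (1 / \<epsilon>) * r) ^ d"
      using r by (simp add: power_mult_distrib mult_right_mono)
    also have "\<dots> \<le> flip_ratio S n ^ d"
    proof (rule power_mono)
      have "S * (1 / 2) \<le> S * (1 - x)"
        using x S by (intro mult_left_mono) auto
      then have "r \<le> real n powr (- S / 2)"
        unfolding r_def using n by (intro powr_mono) auto
      then have "2 powr (1 / \<epsilon>) * r \<le> 2 powr (1 / \<epsilon>) * real n powr (- S / 2)"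
        by (rule mult_left_mono) simp
      then show "2 powr (1 / \<epsilon>) * r \<le> flip_ratio S n"
        unfolding flip_ratio_def \<epsilon>(3) by (simp add: add_increasing)
    qed (simp add: r)
    finally show ?thesis .
  qed
  then show ?thesis
    by (simp only: exp)
qed

lemma sum_power_from_1_le:
  fixes q :: real
  assumes "0 \<le> q" "q < 1"
  shows "(\<Sum>d=1..k. q ^ d) \<le> q / (1 - q)"
proof -
  have "(1 - q) * (\<Sum>d=1..k. q ^ d) \<le> q"
    using sum_gp_multiplied[of 1 k q] assms by (cases k) auto
  then show ?thesis
    using assms by (simp add: field_simps)
qed

theorem theorem10:
  fixes \<alpha> \<beta> \<tau> SNR :: real
    and \<mu>1 \<mu>2 :: "nat \<Rightarrow> real"
    and M :: "nat \<Rightarrow> 'a measure"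
    and \<sigma>star :: "nat \<Rightarrow> nat \<Rightarrow> real"
    and A :: "nat \<Rightarrow> nat \<Rightarrow> nat \<Rightarrow> 'a \<Rightarrow> real"
    and \<sigma>MLE :: "nat \<Rightarrow> 'a \<Rightarrow> nat \<Rightarrow> real"
  assumes "\<alpha> > \<beta>" and "\<tau> > 0"
    and "\<And>n. \<mu>1 n = \<alpha> * sqrt (ln (real n) / real n)"
    and "\<And>n. \<mu>2 n = \<beta> * sqrt (ln (real n) / real n)"
    and "\<And>n. even n \<Longrightarrow> n > 0 \<Longrightarrow> gaussian_sbm (M n) n (\<mu>1 n) (\<mu>2 n) (\<tau>\<^sup>2) (\<sigma>star n) (A n)"
    and "\<And>n. even n \<Longrightarrow> n > 0 \<Longrightarrow> is_mle (M n) n (A n) (\<sigma>MLE n)"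
    and "SNR = (\<alpha> - \<beta>)\<^sup>2 / (8 * \<tau>\<^sup>2)"
    and "SNR > 1"
  shows "((\<lambda>n. \<P>(\<omega> in M n. agreement n (\<sigma>MLE n \<omega>) (\<sigma>star n) = 1)) \<longlongrightarrow> 1)
           (inf sequentially (principal {n. even n}))"
proof -
  let ?P = "\<lambda>n. \<P>(\<omega> in M n. agreement n (\<sigma>MLE n \<omega>) (\<sigma>star n) = 1)"
  let ?F = "inf sequentially (principal {n::nat. even n})"
  let ?q = "flip_ratio SNR"
  have q0: "?q \<longlonglongrightarrow> 0"
    using assms(8) by (rule flip_ratio_tendsto_0)
  have q_nonneg: "?q n \<ge> 0" for n
    by (simp add: flip_ratio_def)
  have lower: "1 - ?q n / (1 - ?q n) \<le> ?P n" if n: "even n" "n > 0" and q: "?q n < 1" for n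
  proof -
    interpret gaussian_sbm "M n" n "\<mu>1 n" "\<mu>2 n" "\<tau>\<^sup>2" "\<sigma>star n" "A n"
      using assms(5) n by blast
    have ln: "ln (real n) / real n \<ge> 0"
      using n by (simp add: Suc_le_eq)
    have mu: "\<mu>2 n \<le> \<mu>1 n"
      using assms(1) ln by (simp add: assms(3,4) mult_right_mono)
    have "\<mu>1 n - \<mu>2 n = (\<alpha> - \<beta>) * sqrt (ln (real n) / real n)"
      by (simp only: assms(3,4) left_diff_distrib)
    then have gap: "(\<mu>1 n - \<mu>2 n)\<^sup>2 = (\<alpha> - \<beta>)\<^sup>2 * (ln (real n) / real n)"
      using ln by (simp only: power_mult_distrib real_sqrt_pow2)
    have "1 - ?P n \<le> (\<Sum>d=1..n div 2. real (n choose d)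
        * exp (- (real d * real (n - d) * (\<mu>1 n - \<mu>2 n)\<^sup>2 / (8 * \<tau>\<^sup>2))))"
      using assms(2) n by (intro prob_mle_fails_le mu assms(6)) auto
    also have "\<dots> = (\<Sum>d=1..n div 2. real (n choose d)
        * exp (- (SNR * ln (real n) * (real d * real (n - d) / real n))))"
      by (simp add: gap assms(7) mult_ac)
    also have "\<dots> \<le> (\<Sum>d=1..n div 2. ?q n ^ d)"
      using assms(8) by (intro sum_mono binomial_mult_exp_le) auto
    also have "\<dots> \<le> ?q n / (1 - ?q n)"
      using q_nonneg q by (rule sum_power_from_1_le)
    finally show ?thesis
      by simp
  qed
  have upper: "?P n \<le> 1" if n: "even n" "n > 0" for n
  proof -
    interpret gaussian_sbm "M n" n "\<mu>1 n" "\<mu>2 n" "\<tau>\<^sup>2" "\<sigma>star n" "A n"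
      using assms(5) n by blast
    show ?thesis
      by simp
  qed
  have ev: "\<forall>\<^sub>F n in ?F. even n \<and> n > 0 \<and> ?q n < 1"
    unfolding eventually_inf_principal
    using order_tendstoD(2)[OF q0, of 1] eventually_gt_at_top[of "0::nat"]
    by (auto elim!: eventually_elim2)
  show ?thesis
  proof (rule tendsto_sandwich)
    show "\<forall>\<^sub>F n in ?F. 1 - ?q n / (1 - ?q n) \<le> ?P n"
      using ev by eventually_elim (rule lower; simp)
    show "\<forall>\<^sub>F n in ?F. ?P n \<le> 1"
      using ev by eventually_elim (rule upper; simp)
    have "(\<lambda>n. 1 - ?q n / (1 - ?q n)) \<longlonglongrightarrow> 1 - 0 / (1 - 0)"
      by (intro tendsto_intros q0) simp
    then show "((\<lambda>n. 1 - ?q n / (1 - ?q n)) \<longlongrightarrow> 1) ?F"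
      by (simp add: tendsto_mono[OF inf_le1])
  qed simp
qed

end
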